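(* Let $\mathcal A,\mathcal B$ be (binary) unital associative algebras over $\mathbb C$ with involutions $a\mapsto a^\star$ and $b\mapsto b^\ast$ respectively, let $\mathcal M$ be an $\mathcal A$-$\mathcal B$-bimodule with associated $\mathcal B$-$\mathcal A$-bimodule $\overline{\mathcal M}$, and let $\varphi:\mathcal M\otimes_{\mathcal B}\overline{\mathcal M}\to\mathcal A$ and $\psi:\overline{\mathcal M}\otimes_{\mathcal A}\mathcal M\to\mathcal B$ be homomorphisms of $\mathcal A$-bimodules and of $\mathcal B$-bimodules respectively such that for all $m,n,p\in\mathcal M$ $$(\varphi(m\otimes\bar n))^\star=\varphi(n\otimes\bar m),\quad(\psi(\bar m\otimes n))^\ast=\psi(\bar n\otimes m),\quad\varphi(m\otimes\bar n)\cdot p=m\cdot\psi(\bar n\otimes p).$$ Define the ternary multiplication $\sigma$ on $\mathcal M$ by $\sigma(m,n,p)=\varphi(m\otimes\bar n)\cdot p+m\cdot\psi(\bar n\otimes p)$ for $m,n,p\in\mathcal M$. Then $(\mathcal M,\sigma)$ is a ternary algebra of Jordan type, and $\sigma$ satisfies, for all $m,n,p,q,r\in\mathcal M$, the identity $$\sigma(m,n,\sigma(p,q,r))-\sigma(p,q,\sigma(m,n,r))+\sigma(\sigma(p,q,m),n,r)-\sigma(m,\sigma(q,p,n),r)=0.$$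
   Context: A ternary algebra $(\mathfrak A,\sigma)$ is a complex vector space $\mathfrak A$ with a trilinear map $\sigma:\mathfrak A\times\mathfrak A\times\mathfrak A\to\mathfrak A$ (a ternary multiplication). A ternary algebra $(\mathfrak A,\sigma)$, where in general $\sigma(\sigma(a,b,c),d,f)\neq\sigma(a,b,\sigma(c,d,f))$, is said to be of Jordan type if for all $a,b,c\in\mathfrak A$ $$\sigma(a,b,c)=\sigma(c,b,a),\qquad \sigma(\sigma(a,b,c),b,\sigma(a,b,a))=\sigma(a,b,\sigma(c,b,\sigma(a,b,a))).$$ The bimodule $\mathcal M$ is regarded as a vector space over $\mathbb C$. $\overline{\mathcal M}$ is an abelian group isomorphic to the abelian group $\mathcal M$ via an isomorphism $\varepsilon:\mathcal M\to\overline{\mathcal M}$, written $\varepsilon(m)=\bar m$, and it is made into a $\mathcal B$-$\mathcal A$-bimodule by $\varepsilon(m)\cdot a=\varepsilon(a^\star\cdot m)$ and $b\cdot\varepsilon(m)=\varepsilon(m\cdot b^\ast)$ for $m\in\mathcal M$, $a\in\mathcal A$, $b\in\mathcal B$. The tensor product $\mathcal M\otimes_{\mathcal B}\overline{\mathcal M}$ is an $\mathcal A$-bimodule and $\overline{\mathcal M}\otimes_{\mathcal A}\mathcal M$ is a $\mathcal B$-bimodule, and $\mathcal A$, $\mathcal B$ are regarded as bimodules over themselves.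
   Formalization: The second summand of σ is p·ψ(n̄⊗m) instead of the printed m·ψ(n̄⊗p), for which σ(m,n,p)=σ(p,n,m) fails (2×2 matrices with transposition, φ(m⊗n̄)=mnᵀ, ψ(n̄⊗p)=nᵀp); involutions are taken ℂ-linear, as trilinearity of σ requires. *)

theory Defs
  imports Complex_Main "HOL-Algebra.Free_Abelian_Groups"
begin

section \<open>Algebras with involution\<close>

text \<open>The sort \<open>{ring, monoid_mult}\<close> is that of unital associative rings in which \<open>0 = 1\<close> is not
  excluded (unlike in \<open>ring_1\<close>), so that the zero algebra is admitted.\<close>

locale complex_algebra = vector_space scale
  for scale :: "complex \<Rightarrow> 'a::{ring, monoid_mult} \<Rightarrow> 'a" +
  assumes scale_mult_left: "scale c x * y = scale c (x * y)"
    and scale_mult_right: "x * scale c y = scale c (x * y)"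

text \<open>Involutions are complex linear, not conjugate linear: with a conjugate linear involution the
  ternary product below would be conjugate linear, hence not linear, in its middle argument.\<close>

locale complex_algebra_with_involution = complex_algebra scale
  for scale :: "complex \<Rightarrow> 'a::{ring, monoid_mult} \<Rightarrow> 'a" +
  fixes star :: "'a \<Rightarrow> 'a"
  assumes star_linear: "Vector_Spaces.linear scale scale star"
    and star_mult: "star (x * y) = star y * star x"
    and star_star: "star (star x) = x"


section \<open>Bimodules\<close>

text \<open>\<open>lact a m\<close> is \<open>a \<cdot> m\<close> and \<open>ract m b\<close> is \<open>m \<cdot> b\<close>.  The complex scalars of the two algebras
  act on a bimodule in the same way.\<close>

locale bimodule = A: complex_algebra scaleA + B: complex_algebra scaleB + vector_space scaleM
  for scaleA :: "complex \<Rightarrow> 'a::{ring, monoid_mult} \<Rightarrow> 'a"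
    and scaleB :: "complex \<Rightarrow> 'b::{ring, monoid_mult} \<Rightarrow> 'b"
    and scaleM :: "complex \<Rightarrow> 'm::ab_group_add \<Rightarrow> 'm" +
  fixes lact :: "'a \<Rightarrow> 'm \<Rightarrow> 'm" and ract :: "'m \<Rightarrow> 'b \<Rightarrow> 'm"
  assumes lact_add: "lact a (x + y) = lact a x + lact a y"
    and add_lact: "lact (a + a') x = lact a x + lact a' x"
    and lact_mult: "lact (a * a') x = lact a (lact a' x)"
    and lact_one: "lact 1 x = x"
    and ract_add: "ract (x + y) b = ract x b + ract y b"
    and add_ract: "ract x (b + b') = ract x b + ract x b'"
    and ract_mult: "ract x (b * b') = ract (ract x b) b'"
    and ract_one: "ract x 1 = x"
    and lact_ract: "ract (lact a x) b = lact a (ract x b)"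
    and lact_scale: "lact (scaleA c a) x = scaleM c (lact a x)"
    and ract_scale: "ract x (scaleB c b) = scaleM c (ract x b)"

locale conjugate_bimodule =
  bimodule scaleA scaleB scaleM lact ract +
  A: complex_algebra_with_involution scaleA starA +
  B: complex_algebra_with_involution scaleB starB
  for scaleA :: "complex \<Rightarrow> 'a::{ring, monoid_mult} \<Rightarrow> 'a"
    and starA :: "'a \<Rightarrow> 'a"
    and scaleB :: "complex \<Rightarrow> 'b::{ring, monoid_mult} \<Rightarrow> 'b"
    and starB :: "'b \<Rightarrow> 'b"
    and scaleM :: "complex \<Rightarrow> 'm::ab_group_add \<Rightarrow> 'm"
    and lact :: "'a \<Rightarrow> 'm \<Rightarrow> 'm" and ract :: "'m \<Rightarrow> 'b \<Rightarrow> 'm" +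
  fixes bar :: "'m \<Rightarrow> 'n::ab_group_add"
    and bar_lact :: "'b \<Rightarrow> 'n \<Rightarrow> 'n" and bar_ract :: "'n \<Rightarrow> 'a \<Rightarrow> 'n"
  assumes bar_bij: "bij bar"
    and bar_add: "bar (x + y) = bar x + bar y"
    and bar_ract_eq: "bar_ract (bar x) a = bar (lact (starA a) x)"
    and bar_lact_eq: "bar_lact b (bar x) = bar (ract x (starB b))"


section \<open>Tensor products over a noncommutative ring\<close>

text \<open>The tensor product of a right module (action \<open>ract\<close>) and a left module (action \<open>lact\<close>) over
  the same ring: the free abelian group on all pairs modulo the subgroup generated by the usual
  relations.  Its elements are cosets of that subgroup.\<close>

definition tensor_relations ::
  "('m::ab_group_add \<Rightarrow> 'r \<Rightarrow> 'm) \<Rightarrow> ('r \<Rightarrow> 'n::ab_group_add \<Rightarrow> 'n) \<Rightarrow> ('m \<times> 'n \<Rightarrow>\<^sub>0 int) set" where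
  "tensor_relations ract lact =
     {frag_of (x + x', y) - frag_of (x, y) - frag_of (x', y) | x x' y. True} \<union>
     {frag_of (x, y + y') - frag_of (x, y) - frag_of (x, y') | x y y'. True} \<union>
     {frag_of (ract x r, y) - frag_of (x, lact r y) | x r y. True}"

definition tensor_kernel ::
  "('m::ab_group_add \<Rightarrow> 'r \<Rightarrow> 'm) \<Rightarrow> ('r \<Rightarrow> 'n::ab_group_add \<Rightarrow> 'n) \<Rightarrow> ('m \<times> 'n \<Rightarrow>\<^sub>0 int) set" where
  "tensor_kernel ract lact = generate (free_Abelian_group UNIV) (tensor_relations ract lact)"

definition tensor_product ::
  "('m::ab_group_add \<Rightarrow> 'r \<Rightarrow> 'm) \<Rightarrow> ('r \<Rightarrow> 'n::ab_group_add \<Rightarrow> 'n) \<Rightarrow> ('m \<times> 'n \<Rightarrow>\<^sub>0 int) set monoid"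
  where "tensor_product ract lact = free_Abelian_group UNIV Mod tensor_kernel ract lact"

definition pure_tensor ::
  "('m::ab_group_add \<Rightarrow> 'r \<Rightarrow> 'm) \<Rightarrow> ('r \<Rightarrow> 'n::ab_group_add \<Rightarrow> 'n) \<Rightarrow> 'm \<Rightarrow> 'n \<Rightarrow>
    ('m \<times> 'n \<Rightarrow>\<^sub>0 int) set" where
  "pure_tensor ract lact x y = tensor_kernel ract lact #>\<^bsub>free_Abelian_group UNIV\<^esub> frag_of (x, y)"

text \<open>The endomorphism \<open>f \<otimes> g\<close> of the tensor product, for module endomorphisms \<open>f\<close> and \<open>g\<close>.  The
  image of a coset need not be a full coset, so the kernel is added again.\<close>

definition tensor_map ::
  "('m::ab_group_add \<Rightarrow> 'r \<Rightarrow> 'm) \<Rightarrow> ('r \<Rightarrow> 'n::ab_group_add \<Rightarrow> 'n) \<Rightarrow> ('m \<Rightarrow> 'm) \<Rightarrow> ('n \<Rightarrow> 'n) \<Rightarrow>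
    ('m \<times> 'n \<Rightarrow>\<^sub>0 int) set \<Rightarrow> ('m \<times> 'n \<Rightarrow>\<^sub>0 int) set" where
  "tensor_map ract lact f g t =
     tensor_kernel ract lact <#>\<^bsub>free_Abelian_group UNIV\<^esub>
       frag_extend (\<lambda>(x, y). frag_of (f x, g y)) ` t"

definition additive_group :: "'a::ab_group_add monoid" where
  "additive_group = \<lparr>carrier = UNIV, monoid.mult = (+), one = 0\<rparr>"

text \<open>Homomorphisms from a tensor product \<open>X \<otimes>\<^sub>R Y\<close> to a ring \<open>S\<close>, both regarded as
  \<open>S\<close>-bimodules: \<open>S\<close> acts on the tensor product from the left through \<open>X\<close> (action \<open>lX\<close>) and from
  the right through \<open>Y\<close> (action \<open>rY\<close>), and on itself by multiplication.\<close>

definition tensor_bimodule_hom ::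
  "('m::ab_group_add \<Rightarrow> 'r \<Rightarrow> 'm) \<Rightarrow> ('r \<Rightarrow> 'n::ab_group_add \<Rightarrow> 'n) \<Rightarrow>
    ('s \<Rightarrow> 'm \<Rightarrow> 'm) \<Rightarrow> ('n \<Rightarrow> 's \<Rightarrow> 'n) \<Rightarrow> (('m \<times> 'n \<Rightarrow>\<^sub>0 int) set \<Rightarrow> 's::ring) \<Rightarrow> bool" where
  "tensor_bimodule_hom rX lY lX rY h \<longleftrightarrow>
     h \<in> hom (tensor_product rX lY) additive_group \<and>
     (\<forall>s. \<forall>t \<in> carrier (tensor_product rX lY).
        h (tensor_map rX lY (lX s) id t) = s * h t \<and>
        h (tensor_map rX lY id (\<lambda>y. rY y s) t) = h t * s)"


section \<open>Ternary algebras\<close>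

locale ternary_algebra = vector_space scale
  for scale :: "complex \<Rightarrow> 'm::ab_group_add \<Rightarrow> 'm" +
  fixes \<sigma> :: "'m \<Rightarrow> 'm \<Rightarrow> 'm \<Rightarrow> 'm"
  assumes linear_1: "Vector_Spaces.linear scale scale (\<lambda>a. \<sigma> a b c)"
    and linear_2: "Vector_Spaces.linear scale scale (\<lambda>b. \<sigma> a b c)"
    and linear_3: "Vector_Spaces.linear scale scale (\<lambda>c. \<sigma> a b c)"

locale jordan_ternary_algebra = ternary_algebra scale \<sigma>
  for scale :: "complex \<Rightarrow> 'm::ab_group_add \<Rightarrow> 'm" and \<sigma> :: "'m \<Rightarrow> 'm \<Rightarrow> 'm \<Rightarrow> 'm" +
  assumes symmetric: "\<sigma> a b c = \<sigma> c b a"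
    and jordan: "\<sigma> (\<sigma> a b c) b (\<sigma> a b a) = \<sigma> a b (\<sigma> c b (\<sigma> a b a))"

text \<open>The product \<open>\<sigma>(m, n, p) = \<phi>(m \<otimes> bar n) \<cdot> p + p \<cdot> \<psi>(bar n \<otimes> m)\<close>.  The second summand is not
  \<open>m \<cdot> \<psi>(bar n \<otimes> p)\<close>: that expression equals \<open>\<phi>(m \<otimes> bar n) \<cdot> p\<close> under the compatibility assumption
  on \<open>\<phi>\<close> and \<open>\<psi>\<close>, and the resulting product \<open>2 \<phi>(m \<otimes> bar n) \<cdot> p\<close> is not symmetric in \<open>m\<close> and \<open>p\<close>
  in general.  For square matrices with transposition, \<open>\<phi>(m \<otimes> bar n) = m n\<^sup>T\<close> and
  \<open>\<psi>(bar n \<otimes> p) = n\<^sup>T p\<close>, it is \<open>2 m n\<^sup>T p\<close>, whereas the product used here is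
  \<open>m n\<^sup>T p + p n\<^sup>T m\<close>.\<close>

definition ternary_product ::
  "('a \<Rightarrow> 'm::ab_group_add \<Rightarrow> 'm) \<Rightarrow> ('m \<Rightarrow> 'b \<Rightarrow> 'm) \<Rightarrow> ('m \<Rightarrow> 'n::ab_group_add) \<Rightarrow>
    ('b \<Rightarrow> 'n \<Rightarrow> 'n) \<Rightarrow> ('n \<Rightarrow> 'a \<Rightarrow> 'n) \<Rightarrow>
    (('m \<times> 'n \<Rightarrow>\<^sub>0 int) set \<Rightarrow> 'a) \<Rightarrow> (('n \<times> 'm \<Rightarrow>\<^sub>0 int) set \<Rightarrow> 'b) \<Rightarrow>
    'm \<Rightarrow> 'm \<Rightarrow> 'm \<Rightarrow> 'm" where
  "ternary_product lact ract bar bar_lact bar_ract \<phi> \<psi> m n p =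
     lact (\<phi> (pure_tensor ract bar_lact m (bar n))) p +
     ract p (\<psi> (pure_tensor bar_ract lact (bar n) m))"

end

theory Submission
  imports Defs
begin

text \<open>The triple product \<open>\<tau>(m, n, p) = \<phi>(m \<otimes> bar n) \<cdot> p\<close> is an associative triple product of the
  second kind: bimodule linearity of \<open>\<phi>\<close> and compatibility with the involution let every iterated
  product be rebracketed to the right, at the cost of reversing the order inside a middle factor.
  The compatibility of \<open>\<phi>\<close> and \<open>\<psi>\<close> turns \<open>\<sigma>\<close> into the symmetrisation of \<open>\<tau>\<close> in its outer
  arguments, and in terms of right-nested \<open>\<tau>\<close>-products both identities become equalities of sums
  of the same monomials.\<close>


section \<open>Symmetrisation of an associative triple product\<close>

text \<open>The model is a b* c for an involution *. There (d c* b)* = b* c d*, which accounts for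
  the reversed order in the middle argument of \<open>assoc_middle\<close>.\<close>

locale associative_triple_system = ternary_algebra scale \<tau>
  for scale :: "complex \<Rightarrow> 'm::ab_group_add \<Rightarrow> 'm" and \<tau> :: "'m \<Rightarrow> 'm \<Rightarrow> 'm \<Rightarrow> 'm" +
  assumes assoc_left: "\<tau> (\<tau> a b c) d e = \<tau> a b (\<tau> c d e)"
    and assoc_middle: "\<tau> a (\<tau> d c b) e = \<tau> a b (\<tau> c d e)"
begin

interpretation endo: vector_space_pair scale scale ..

lemma add_1: "\<tau> (a + a') b c = \<tau> a b c + \<tau> a' b c"
  using linear_1[of b c] by (rule endo.linear_add)

lemma add_2: "\<tau> a (b + b') c = \<tau> a b c + \<tau> a b' c"
  using linear_2[of a c] by (rule endo.linear_add)

lemma add_3: "\<tau> a b (c + c') = \<tau> a b c + \<tau> a b c'"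
  using linear_3[of a b] by (rule endo.linear_add)

lemmas right_nested = add_1 add_2 add_3 assoc_left assoc_middle

definition sym_product :: "'m \<Rightarrow> 'm \<Rightarrow> 'm \<Rightarrow> 'm" where
  "sym_product a b c = \<tau> a b c + \<tau> c b a"

lemma jordan_ternary_algebra_sym_product: "jordan_ternary_algebra scale sym_product"
proof (intro jordan_ternary_algebra.intro ternary_algebra.intro ternary_algebra_axioms.intro
    jordan_ternary_algebra_axioms.intro)
  show "vector_space scale" ..
  show "Vector_Spaces.linear scale scale (\<lambda>a. sym_product a b c)" for b c
    unfolding sym_product_def
    by (intro endo.linear_compose_add linear_1 linear_3)
  show "Vector_Spaces.linear scale scale (\<lambda>b. sym_product a b c)" for a c
    unfolding sym_product_def
    by (intro endo.linear_compose_add linear_2)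
  show "Vector_Spaces.linear scale scale (\<lambda>c. sym_product a b c)" for a b
    unfolding sym_product_def
    by (intro endo.linear_compose_add linear_1 linear_3)
  show "sym_product a b c = sym_product c b a" for a b c
    by (simp add: sym_product_def add.commute)
  show "sym_product (sym_product a b c) b (sym_product a b a) =
      sym_product a b (sym_product c b (sym_product a b a))" for a b c
    \<comment> \<open>As \<open>sym_product a b a\<close> is twice \<open>\<tau> a b a\<close>, both
      sides expand to the same four right-nested monomials, each occurring twice.\<close>
    by (simp add: sym_product_def right_nested algebra_simps)
qed

text \<open>With D(a, b) for the map sending r to \<open>sym_product a b r\<close>, this is the
  Jordan triple identity [D(p, q), D(m, n)] = D(D(p, q) m, n) - D(m, D(q, p) n). The right-nested
  monomials cancel in pairs.\<close>

lemma sym_product_identity: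
  "sym_product m n (sym_product p q r) - sym_product p q (sym_product m n r) +
    sym_product (sym_product p q m) n r - sym_product m (sym_product q p n) r = 0"
  by (simp add: sym_product_def right_nested algebra_simps)

end


section \<open>Pure tensors\<close>

lemma subgroup_tensor_kernel:
  "subgroup (tensor_kernel ract lact) (free_Abelian_group UNIV)"
  unfolding tensor_kernel_def
  by (rule group.generate_is_subgroup) auto

lemma normal_tensor_kernel: "tensor_kernel ract lact \<lhd> free_Abelian_group UNIV"
  by (rule comm_group.subgroup_imp_normal[OF abelian_free_Abelian_group subgroup_tensor_kernel])

lemma tensor_relations_subset_kernel: "tensor_relations ract lact \<subseteq> tensor_kernel ract lact"
  unfolding tensor_kernel_def by (auto intro: generate.incl)

lemma mem_tensor_coset_iff:
  "u \<in> tensor_kernel ract lact #>\<^bsub>free_Abelian_group UNIV\<^esub> v \<longleftrightarrow> u - v \<in> tensor_kernel ract lact"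
  by (force simp: r_coset_def)

lemma mem_pure_tensor_iff:
  "u \<in> pure_tensor ract lact x y \<longleftrightarrow> u - frag_of (x, y) \<in> tensor_kernel ract lact"
  by (simp add: pure_tensor_def mem_tensor_coset_iff)

lemma tensor_coset_eqI:
  assumes "u - v \<in> tensor_kernel ract lact"
  shows "tensor_kernel ract lact #>\<^bsub>free_Abelian_group UNIV\<^esub> u =
    tensor_kernel ract lact #>\<^bsub>free_Abelian_group UNIV\<^esub> v"
proof -
  have "u \<in> tensor_kernel ract lact #>\<^bsub>free_Abelian_group UNIV\<^esub> v"
    using assms by (simp add: mem_tensor_coset_iff)
  then show ?thesis
    by (intro group.repr_independence[symmetric] subgroup_tensor_kernel) auto
qed

lemma pure_tensor_in_carrier: "pure_tensor ract lact x y \<in> carrier (tensor_product ract lact)"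
  by (auto simp: pure_tensor_def tensor_product_def FactGroup_def RCOSETS_def)

lemma pure_tensor_mult:
  "pure_tensor ract lact x y \<otimes>\<^bsub>tensor_product ract lact\<^esub> pure_tensor ract lact x' y' =
    tensor_kernel ract lact #>\<^bsub>free_Abelian_group UNIV\<^esub> (frag_of (x, y) + frag_of (x', y'))"
  using normal.rcos_sum[OF normal_tensor_kernel, of "frag_of (x, y)" "frag_of (x', y')" ract lact]
  by (simp add: pure_tensor_def tensor_product_def FactGroup_def)

lemma pure_tensor_add_left:
  "pure_tensor ract lact (x + x') y =
    pure_tensor ract lact x y \<otimes>\<^bsub>tensor_product ract lact\<^esub> pure_tensor ract lact x' y"
  unfolding pure_tensor_mult unfolding pure_tensor_def
  \<comment> \<open>The difference of the two representatives is itself a defining relation, once u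
    - (v + w) is rewritten as u - v - w.\<close>
  by (intro tensor_coset_eqI subsetD[OF tensor_relations_subset_kernel])
    (unfold tensor_relations_def diff_diff_add[symmetric], blast)

lemma pure_tensor_add_right:
  "pure_tensor ract lact x (y + y') =
    pure_tensor ract lact x y \<otimes>\<^bsub>tensor_product ract lact\<^esub> pure_tensor ract lact x y'"
  unfolding pure_tensor_mult unfolding pure_tensor_def
  by (intro tensor_coset_eqI subsetD[OF tensor_relations_subset_kernel])
    (unfold tensor_relations_def diff_diff_add[symmetric], blast)

text \<open>This makes f \<otimes> g well defined: additivity and compatibility with the actions
  send each relation to a relation of the same shape, and the induced map on the free group is
  additive.\<close>

lemma tensor_kernel_frag_extend:
  assumes f: "\<And>x x'. f (x + x') = f x + f x'" "\<And>x r. f (ract x r) = ract (f x) r"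
    and g: "\<And>y y'. g (y + y') = g y + g y'" "\<And>y r. g (lact r y) = lact r (g y)"
    and k: "k \<in> tensor_kernel ract lact"
  shows "frag_extend (\<lambda>(x, y). frag_of (f x, g y)) k \<in> tensor_kernel ract lact"
proof -
  let ?F = "frag_extend (\<lambda>(x, y). frag_of (f x, g y))"
  have rel: "?F u \<in> tensor_relations ract lact" if "u \<in> tensor_relations ract lact" for u
    using that unfolding tensor_relations_def
    by (auto simp: frag_extend_diff f g) blast+
  show ?thesis
    using k unfolding tensor_kernel_def
  proof (induction rule: generate.induct)
    case one
    then show ?case
      using generate.one[of "free_Abelian_group UNIV"] by simp
  next
    case (incl u)
    then show ?case
      by (intro generate.incl rel)
  next
    case (inv u)
    then show ?case
      using generate.inv[OF rel[OF inv], of "free_Abelian_group UNIV"]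
      by (simp add: frag_extend_minus)
  next
    case (eng u v)
    then show ?case
      using generate.eng[OF eng.IH] by (simp add: frag_extend_add)
  qed
qed

lemma tensor_map_pure_tensor:
  assumes f: "\<And>x x'. f (x + x') = f x + f x'" "\<And>x r. f (ract x r) = ract (f x) r"
    and g: "\<And>y y'. g (y + y') = g y + g y'" "\<And>y r. g (lact r y) = lact r (g y)"
  shows "tensor_map ract lact f g (pure_tensor ract lact x y) = pure_tensor ract lact (f x) (g y)"
proof (intro equalityI subsetI)
  let ?F = "frag_extend (\<lambda>(x, y). frag_of (f x, g y))"
  let ?K = "tensor_kernel ract lact"
  interpret K: subgroup ?K "free_Abelian_group UNIV"
    by (rule subgroup_tensor_kernel)
  fix z
  show "z \<in> pure_tensor ract lact (f x) (g y)"
    if "z \<in> tensor_map ract lact f g (pure_tensor ract lact x y)"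
  proof -
    obtain h u where z: "z = h + ?F u" and "h \<in> ?K" and "u \<in> pure_tensor ract lact x y"
      using \<open>z \<in> tensor_map _ _ _ _ _\<close> unfolding tensor_map_def set_mult_def by auto
    then have "u - frag_of (x, y) \<in> ?K"
      by (simp add: mem_pure_tensor_iff)
    \<comment> \<open>Any representative u differs from \<open>frag_of (x, y)\<close> by a kernel
      element, whose image stays in the kernel.\<close>
    with f g have "?F (u - frag_of (x, y)) \<in> ?K"
      by (rule tensor_kernel_frag_extend)
    with \<open>h \<in> ?K\<close> have "h + ?F (u - frag_of (x, y)) \<in> ?K"
      using K.m_closed by fastforce
    then show ?thesis
      by (simp add: z mem_pure_tensor_iff frag_extend_diff add_diff_eq)
  qed
  show "z \<in> tensor_map ract lact f g (pure_tensor ract lact x y)"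
    if "z \<in> pure_tensor ract lact (f x) (g y)"
  proof -
    \<comment> \<open>Conversely, this single representative suffices: the kernel summand in
      \<open>tensor_map\<close> fills up the rest of the coset.\<close>
    have "frag_of (x, y) \<in> pure_tensor ract lact x y"
      using K.one_closed by (simp add: mem_pure_tensor_iff)
    then have "?F (frag_of (x, y)) \<in> ?F ` pure_tensor ract lact x y"
      by (rule imageI)
    moreover have "z - frag_of (f x, g y) \<in> ?K"
      using that by (simp add: mem_pure_tensor_iff)
    moreover have "z = (z - frag_of (f x, g y)) + ?F (frag_of (x, y))"
      by simp
    ultimately show ?thesis
      unfolding tensor_map_def set_mult_def mult_free_Abelian_group by blast
  qed
qed


section \<open>Bimodule homomorphisms on pure tensors\<close>

lemma tensor_bimodule_hom_add_left:
  assumes "tensor_bimodule_hom rX lY lX rY h"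
  shows "h (pure_tensor rX lY (x + x') y) = h (pure_tensor rX lY x y) + h (pure_tensor rX lY x' y)"
  using assms
  by (auto simp: tensor_bimodule_hom_def hom_def additive_group_def pure_tensor_add_left
      pure_tensor_in_carrier)

lemma tensor_bimodule_hom_add_right:
  assumes "tensor_bimodule_hom rX lY lX rY h"
  shows "h (pure_tensor rX lY x (y + y')) = h (pure_tensor rX lY x y) + h (pure_tensor rX lY x y')"
  using assms
  by (auto simp: tensor_bimodule_hom_def hom_def additive_group_def pure_tensor_add_right
      pure_tensor_in_carrier)

text \<open>The two conditions on \<open>lX s\<close> are what allows \<open>tensor_map\<close> to
  be evaluated on pure tensors.\<close>

lemma tensor_bimodule_hom_act_left:
  assumes "tensor_bimodule_hom rX lY lX rY h"
    and "\<And>x x'. lX s (x + x') = lX s x + lX s x'" "\<And>x r. lX s (rX x r) = rX (lX s x) r"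
  shows "h (pure_tensor rX lY (lX s x) y) = s * h (pure_tensor rX lY x y)"
proof -
  have "tensor_map rX lY (lX s) id (pure_tensor rX lY x y) = pure_tensor rX lY (lX s x) y"
    using tensor_map_pure_tensor[of "lX s" rX id lY x y] assms(2,3) by simp
  then show ?thesis
    using assms(1) by (metis tensor_bimodule_hom_def pure_tensor_in_carrier)
qed

lemma tensor_bimodule_hom_act_right:
  assumes "tensor_bimodule_hom rX lY lX rY h"
    and "\<And>y y'. rY (y + y') s = rY y s + rY y' s" "\<And>y r. rY (lY r y) s = lY r (rY y s)"
  shows "h (pure_tensor rX lY x (rY y s)) = h (pure_tensor rX lY x y) * s"
proof -
  have "tensor_map rX lY id (\<lambda>y. rY y s) (pure_tensor rX lY x y) = pure_tensor rX lY x (rY y s)"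
    using tensor_map_pure_tensor[of id rX "\<lambda>y. rY y s" lY x y] assms(2,3) by simp
  then show ?thesis
    using assms(1) by (metis tensor_bimodule_hom_def pure_tensor_in_carrier)
qed


section \<open>The triple product of a conjugate bimodule\<close>

context conjugate_bimodule
begin

lemma starA_one: "starA 1 = 1"
  by (metis A.star_mult A.star_star mult_1)

text \<open>Laws of the conjugate actions are transported from \<open>lact\<close> and
  \<open>ract\<close>, since every element has the form \<open>bar x\<close>.\<close>

lemma bar_ract_add: "bar_ract (u + v) a = bar_ract u a + bar_ract v a"
proof -
  obtain x y where "u = bar x" "v = bar y"
    by (metis bar_bij bij_pointE)
  then show ?thesis
    by (simp add: bar_ract_eq lact_add flip: bar_add)
qed

lemma bar_ract_bar_lact: "bar_ract (bar_lact b u) a = bar_lact b (bar_ract u a)"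
proof -
  obtain x where "u = bar x"
    by (metis bar_bij bij_pointE)
  then show ?thesis
    by (simp add: bar_ract_eq bar_lact_eq lact_ract)
qed

lemma linear_lact: "Vector_Spaces.linear scaleM scaleM (lact a)"
proof (unfold_locales, rule lact_add)
  show "lact a (scaleM c x) = scaleM c (lact a x)" for c x
    \<comment> \<open>The scalar c acts as \<open>scaleA c 1\<close>, which commutes with a.\<close>
    by (metis A.scale_mult_right lact_mult lact_one lact_scale)
qed

text \<open>\<phi> gives an A-valued hermitian form P with P(a m, n) = a P(m, n) and P(m, a n) =
  P(m, n) a*. Taking a to be a value of P yields both associativity laws.\<close>

lemma associative_triple_system_lact:
  assumes hom: "tensor_bimodule_hom ract bar_lact lact bar_ract \<phi>"
    and star: "\<And>m n. starA (\<phi> (pure_tensor ract bar_lact m (bar n))) =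
      \<phi> (pure_tensor ract bar_lact n (bar m))"
  shows "associative_triple_system scaleM
    (\<lambda>m n p. lact (\<phi> (pure_tensor ract bar_lact m (bar n))) p)"
proof -
  define P where "P m n = \<phi> (pure_tensor ract bar_lact m (bar n))" for m n
  have P_add: "P (m + m') n = P m n + P m' n" "P m (n + n') = P m n + P m n'" for m m' n n'
    unfolding P_def bar_add
    by (rule tensor_bimodule_hom_add_left[OF hom] tensor_bimodule_hom_add_right[OF hom])+
  have P_lact: "P (lact a m) n = a * P m n" for a m n
    unfolding P_def
    by (rule tensor_bimodule_hom_act_left[OF hom]) (simp_all add: lact_add lact_ract)
  have P_lact': "P m (lact a n) = P m n * starA a" for a m n
    \<comment> \<open>The right action of \<open>starA a\<close> on \<open>bar n\<close> is
      \<open>bar (lact a n)\<close>, because the two stars cancel.\<close>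
    using tensor_bimodule_hom_act_right[OF hom, where s = "starA a" and x = m and y = "bar n"]
    by (simp add: P_def bar_ract_add bar_ract_bar_lact bar_ract_eq A.star_star)
  have P_star: "starA (P m n) = P n m" for m n
    unfolding P_def by (rule star)
  have scale_eq: "scaleM c m = lact (scaleA c 1) m" for c m
    by (simp add: lact_scale lact_one)
  \<comment> \<open>Complex linearity of \<open>starA\<close> enters here and makes the product
    linear in its middle argument.\<close>
  have starA_scale: "starA (scaleA c 1) = scaleA c 1" for c
    using module_hom.scale[OF A.star_linear[unfolded linear_iff_module_hom]] by (simp add: starA_one)
  show ?thesis
    unfolding P_def[symmetric]
  proof unfold_locales
    show "lact (P (a + a') b) c = lact (P a b) c + lact (P a' b) c" for a a' b c
      by (simp add: P_add add_lact)
    show "lact (P a (b + b')) c = lact (P a b) c + lact (P a b') c" for a b b' c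
      by (simp add: P_add add_lact)
    show "lact (P a b) (c + c') = lact (P a b) c + lact (P a b) c'" for a b c c'
      by (rule lact_add)
    show "lact (P (scaleM k a) b) c = scaleM k (lact (P a b) c)" for k a b c
      by (simp add: scale_eq P_lact lact_mult)
    show "lact (P a (scaleM k b)) c = scaleM k (lact (P a b) c)" for k a b c
      unfolding scale_eq[of k b] P_lact' starA_scale
      by (simp add: A.scale_mult_right lact_scale)
    show "lact (P a b) (scaleM k c) = scaleM k (lact (P a b) c)" for k a b c
      by (rule module_hom.scale[OF linear_lact[unfolded linear_iff_module_hom]])
    show "lact (P (lact (P a b) c) d) e = lact (P a b) (lact (P c d) e)" for a b c d e
      by (simp add: P_lact lact_mult)
    show "lact (P a (lact (P d c) b)) e = lact (P a b) (lact (P c d) e)" for a b c d e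
      by (simp add: P_lact' P_star lact_mult)
  qed
qed

end

theorem proposition3p2:
  fixes scaleA :: "complex \<Rightarrow> 'a::{ring, monoid_mult} \<Rightarrow> 'a"
    and starA :: "'a \<Rightarrow> 'a"
    and scaleB :: "complex \<Rightarrow> 'b::{ring, monoid_mult} \<Rightarrow> 'b"
    and starB :: "'b \<Rightarrow> 'b"
    and scaleM :: "complex \<Rightarrow> 'm::ab_group_add \<Rightarrow> 'm"
    and lact :: "'a \<Rightarrow> 'm \<Rightarrow> 'm" and ract :: "'m \<Rightarrow> 'b \<Rightarrow> 'm"
    and bar :: "'m \<Rightarrow> 'n::ab_group_add"
    and bar_lact :: "'b \<Rightarrow> 'n \<Rightarrow> 'n" and bar_ract :: "'n \<Rightarrow> 'a \<Rightarrow> 'n"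
    and \<phi> :: "('m \<times> 'n \<Rightarrow>\<^sub>0 int) set \<Rightarrow> 'a"
    and \<psi> :: "('n \<times> 'm \<Rightarrow>\<^sub>0 int) set \<Rightarrow> 'b"
    and \<sigma> :: "'m \<Rightarrow> 'm \<Rightarrow> 'm \<Rightarrow> 'm"
  assumes "complex_algebra_with_involution scaleA starA"
    and "complex_algebra_with_involution scaleB starB"
    and "bimodule scaleA scaleB scaleM lact ract"
    and "conjugate_bimodule scaleA starA scaleB starB scaleM lact ract bar bar_lact bar_ract"
    and "tensor_bimodule_hom ract bar_lact lact bar_ract \<phi>"
    and "tensor_bimodule_hom bar_ract lact bar_lact ract \<psi>"
    and "\<And>m n. starA (\<phi> (pure_tensor ract bar_lact m (bar n))) =
                \<phi> (pure_tensor ract bar_lact n (bar m))"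
    and "\<And>m n. starB (\<psi> (pure_tensor bar_ract lact (bar m) n)) =
                \<psi> (pure_tensor bar_ract lact (bar n) m)"
    and "\<And>m n p. lact (\<phi> (pure_tensor ract bar_lact m (bar n))) p =
                  ract m (\<psi> (pure_tensor bar_ract lact (bar n) p))"
    and "\<sigma> = ternary_product lact ract bar bar_lact bar_ract \<phi> \<psi>"
  shows "jordan_ternary_algebra scaleM \<sigma> \<and>
    (\<forall>m n p q r.
       \<sigma> m n (\<sigma> p q r) - \<sigma> p q (\<sigma> m n r) + \<sigma> (\<sigma> p q m) n r - \<sigma> m (\<sigma> q p n) r = 0)"
proof -
  interpret conjugate_bimodule scaleA starA scaleB starB scaleM lact ract bar bar_lact bar_ract
    by fact
  interpret T: associative_triple_system scaleM
    "\<lambda>m n p. lact (\<phi> (pure_tensor ract bar_lact m (bar n))) p"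
    using assms(5,7) by (rule associative_triple_system_lact)
  \<comment> \<open>Compatibility of \<phi> and \<psi>, read from right to left with m and p
    exchanged, turns the \<psi>-summand of \<sigma> into the \<phi>-product of p, n, m.\<close>
  have "\<sigma> = T.sym_product"
    by (simp add: assms(10) ternary_product_def T.sym_product_def fun_eq_iff flip: assms(9))
  then show ?thesis
    using T.jordan_ternary_algebra_sym_product T.sym_product_identity by simp
qed

end
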